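(* Let $k$, $t$, $n$ be integers with $t\geq k+1\geq 2$ and $n\geq 8k+2t-4$. Then \[ AR(n, kP_4\cup tP_2)=AR(n,(2k+t)P_2). \]
   Context: For a positive integer $n$ and a graph $H$, the anti-Ramsey number $AR(n,H)$ is the maximum number of colors in an edge-coloring of the complete graph $K_n$ that contains no rainbow copy of $H$ (a subgraph is rainbow if all its edges receive distinct colors). $P_l$ denotes the path on $l$ vertices, $G\cup G'$ denotes the vertex-disjoint union of graphs, and $kG$ denotes the disjoint union of $k$ copies of $G$ (with $0G$ the empty graph). *)

theory Defs
  imports Main
begin

record 'v graph =
  verts :: "'v set"
  edges :: "'v set set"

definition simple_graph :: "'v graph \<Rightarrow> bool" where
  "simple_graph G \<longleftrightarrow> (\<forall>e \<in> edges G. e \<subseteq> verts G \<and> card e = 2)"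

definition complete_graph :: "nat \<Rightarrow> nat graph" where
  "complete_graph n = \<lparr>verts = {..<n}, edges = {e. e \<subseteq> {..<n} \<and> card e = 2}\<rparr>"

text \<open>The parameter is the number of vertices (not of edges).\<close>

definition path_graph :: "nat \<Rightarrow> nat graph" where
  "path_graph l = \<lparr>verts = {..<l}, edges = {{i, Suc i} | i. Suc i < l}\<rparr>"

definition disjoint_union :: "'a graph \<Rightarrow> 'b graph \<Rightarrow> ('a + 'b) graph" where
  "disjoint_union G H =
     \<lparr>verts = verts G <+> verts H,
      edges = (\<lambda>e. Inl ` e) ` edges G \<union> (\<lambda>e. Inr ` e) ` edges H\<rparr>"

definition copies :: "nat \<Rightarrow> 'a graph \<Rightarrow> (nat \<times> 'a) graph" where
  "copies k G =
     \<lparr>verts = {..<k} \<times> verts G,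
      edges = (\<Union>i<k. (\<lambda>e. Pair i ` e) ` edges G)\<rparr>"

definition subgraph :: "'v graph \<Rightarrow> 'v graph \<Rightarrow> bool" where
  "subgraph H G \<longleftrightarrow> simple_graph H \<and> verts H \<subseteq> verts G \<and> edges H \<subseteq> edges G"

definition graph_iso :: "'a graph \<Rightarrow> 'b graph \<Rightarrow> bool" where
  "graph_iso G H \<longleftrightarrow>
     (\<exists>f. bij_betw f (verts G) (verts H) \<and> edges H = (\<lambda>e. f ` e) ` edges G)"

definition rainbow :: "('v set \<Rightarrow> 'c) \<Rightarrow> 'v graph \<Rightarrow> bool" where
  "rainbow c G \<longleftrightarrow> inj_on c (edges G)"

definition has_rainbow_copy :: "('v set \<Rightarrow> 'c) \<Rightarrow> 'v graph \<Rightarrow> 'h graph \<Rightarrow> bool" where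
  "has_rainbow_copy c G H \<longleftrightarrow> (\<exists>H'. subgraph H' G \<and> graph_iso H H' \<and> rainbow c H')"

text \<open>
  An edge-coloring need not be proper. Only its values on the edges of the complete graph matter,
  and since there are finitely many edges, natural numbers suffice as colors.
  If \<open>H\<close> has at most one edge there may be no admissible coloring, and the
  maximum is then unspecified.
\<close>

definition anti_ramsey :: "nat \<Rightarrow> 'h graph \<Rightarrow> nat" where
  "anti_ramsey n H =
     Max {card (c ` edges (complete_graph n)) | c :: nat set \<Rightarrow> nat.
            \<not> has_rainbow_copy c (complete_graph n) H}"

lemma simple_graph_complete_graph: "simple_graph (complete_graph n)"
  by (simp add: simple_graph_def complete_graph_def)

lemma simple_graph_path_graph: "simple_graph (path_graph l)"
  by (auto simp: simple_graph_def path_graph_def)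

lemma simple_graph_disjoint_union:
  assumes "simple_graph G" "simple_graph H"
  shows "simple_graph (disjoint_union G H)"
  unfolding simple_graph_def
proof
  fix e assume "e \<in> edges (disjoint_union G H)"
  then consider a where "a \<in> edges G" "e = Inl ` a" | b where "b \<in> edges H" "e = Inr ` b"
    unfolding disjoint_union_def by auto
  then show "e \<subseteq> verts (disjoint_union G H) \<and> card e = 2"
  proof cases
    case 1
    then have "a \<subseteq> verts G" "card a = 2" using assms(1) unfolding simple_graph_def by blast+
    then show ?thesis using 1(2) by (auto simp: disjoint_union_def card_image)
  next
    case 2
    then have "b \<subseteq> verts H" "card b = 2" using assms(2) unfolding simple_graph_def by blast+
    then show ?thesis using 2(2) by (auto simp: disjoint_union_def card_image)
  qed
qed

lemma simple_graph_copies: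
  assumes "simple_graph G"
  shows "simple_graph (copies k G)"
  unfolding simple_graph_def
proof
  fix e assume "e \<in> edges (copies k G)"
  then obtain i a where ia: "i < k" "a \<in> edges G" "e = Pair i ` a"
    unfolding copies_def by auto
  then have "a \<subseteq> verts G" "card a = 2" using assms unfolding simple_graph_def by blast+
  moreover have "card (Pair i ` a) = card a" by (rule card_image) (simp add: inj_on_def)
  ultimately show "e \<subseteq> verts (copies k G) \<and> card e = 2"
    using ia(1,3) by (auto simp: copies_def)
qed

lemma finite_edges_complete_graph: "finite (edges (complete_graph n))"
  by (rule finite_subset[of _ "Pow {..<n}"]) (auto simp: complete_graph_def)

lemma finite_color_counts:
  "finite {card (c ` edges (complete_graph n)) | c :: nat set \<Rightarrow> nat.
     \<not> has_rainbow_copy c (complete_graph n) H}"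
proof (rule finite_subset)
  show "{card (c ` edges (complete_graph n)) | c :: nat set \<Rightarrow> nat.
     \<not> has_rainbow_copy c (complete_graph n) H} \<subseteq> {..card (edges (complete_graph n))}"
    using card_image_le[OF finite_edges_complete_graph] by blast
qed simp

lemma color_counts_nonempty:
  assumes "simple_graph H" "e1 \<in> edges H" "e2 \<in> edges H" "e1 \<noteq> e2"
  shows "{card (c ` edges (complete_graph n)) | c :: nat set \<Rightarrow> nat.
     \<not> has_rainbow_copy c (complete_graph n) H} \<noteq> {}"
proof -
  have "\<not> has_rainbow_copy (\<lambda>_. 0 :: nat) (complete_graph n) H"
  proof
    assume "has_rainbow_copy (\<lambda>_. 0 :: nat) (complete_graph n) H"
    then obtain H' :: "nat graph" where "graph_iso H H'" and rb: "rainbow (\<lambda>_. 0 :: nat) H'"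
      unfolding has_rainbow_copy_def by blast
    then obtain f where bij: "bij_betw f (verts H) (verts H')"
      and img: "edges H' = (\<lambda>e. f ` e) ` edges H"
      unfolding graph_iso_def by blast
    have "f ` e1 \<in> edges H'" "f ` e2 \<in> edges H'"
      unfolding img using assms(2,3) by auto
    then have "f ` e1 = f ` e2"
      using rb unfolding rainbow_def by (simp add: inj_on_def)
    moreover have "e1 \<subseteq> verts H" "e2 \<subseteq> verts H"
      using assms by (auto simp: simple_graph_def)
    ultimately show False
      using inj_on_image_eq_iff[OF bij_betw_imp_inj_on[OF bij]] assms(4) by blast
  qed
  then have "card ((\<lambda>_. 0 :: nat) ` edges (complete_graph n)) \<in>
    {card (c ` edges (complete_graph n)) | c :: nat set \<Rightarrow> nat.
      \<not> has_rainbow_copy c (complete_graph n) H}"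
    by (intro CollectI exI[of _ "\<lambda>_. 0 :: nat"] conjI refl)
  then show ?thesis by (metis empty_iff)
qed

end

(* Put m = 2k + t. As kP_4 + tP_2 contains a matching of m edges, only the upper bound needs work.
   Suppose that a coloring has more than AR(n, mP_2) colors but no rainbow kP_4 + tP_2. It has a
   rainbow mP_2, so there is a largest p < k such that some rainbow system consists of p paths P_4
   and s >= m - 2p further edges; choose s maximal, and let r be the number of remaining vertices.
   Take one edge of each color that the system does not use. Rerouting the system along such edges
   would give one more P_4 at the cost of at most two matching edges, or one more matching edge.
   Hence there are none of them between matching edges or between remaining vertices, at most 2r
   between the matching and the remaining vertices, and each P_4 sends at most 4s of them to the
   matching and at most 3r + 3 to the remaining vertices. The resulting bound on the number of
   colors is at most the number of edges meeting a fixed set of m - 2 vertices, plus one, and giving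
   these edges distinct colors and all other edges a single further color shows that AR(n, mP_2)
   is at least that large. *)

theory Submission
  imports Defs "HOL-Library.Multiset"
begin

section \<open>Rainbow copies as injections\<close>

text \<open>An injective \<open>f\<close> also acts injectively on edges, since these are subsets of
  \<open>verts H\<close>. Hence the image is rainbow exactly when the composite coloring is
  injective on \<open>edges H\<close>, and later arguments need no auxiliary subgraph.\<close>

lemma has_rainbow_copy_iff:
  assumes "simple_graph H"
  shows "has_rainbow_copy c (complete_graph n) H \<longleftrightarrow>
    (\<exists>f. inj_on f (verts H) \<and> f ` verts H \<subseteq> {..<n} \<and> inj_on (\<lambda>e. c (f ` e)) (edges H))"
    (is "?L \<longleftrightarrow> ?R")
proof
  assume ?L
  then obtain H' where H': "subgraph H' (complete_graph n)" "graph_iso H H'" "rainbow c H'"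
    unfolding has_rainbow_copy_def by blast
  from H'(2) obtain f where f: "bij_betw f (verts H) (verts H')"
    "edges H' = (\<lambda>e. f ` e) ` edges H"
    unfolding graph_iso_def by blast
  have inj: "inj_on f (verts H)" using f(1) by (rule bij_betw_imp_inj_on)
  have "inj_on (\<lambda>e. f ` e) (edges H)"
    using assms by (intro inj_on_subset[OF inj_on_image_Pow[OF inj]]) (auto simp: simple_graph_def)
  moreover have "inj_on c ((\<lambda>e. f ` e) ` edges H)"
    using H'(3) f(2) by (simp add: rainbow_def)
  ultimately have "inj_on (c \<circ> (\<lambda>e. f ` e)) (edges H)" by (rule comp_inj_on)
  moreover have "f ` verts H \<subseteq> {..<n}"
    using f(1) H'(1) by (auto simp: subgraph_def complete_graph_def bij_betw_def)
  ultimately show ?R using inj by (auto simp: o_def)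
next
  assume ?R
  then obtain f where f: "inj_on f (verts H)" "f ` verts H \<subseteq> {..<n}"
    "inj_on (\<lambda>e. c (f ` e)) (edges H)" by blast
  let ?H = "\<lparr>verts = f ` verts H, edges = (\<lambda>e. f ` e) ` edges H\<rparr>"
  have sub: "e \<subseteq> verts H" "card e = 2" if "e \<in> edges H" for e
    using assms that by (auto simp: simple_graph_def)
  have c2: "card (f ` e) = 2" if "e \<in> edges H" for e
    using sub[OF that] f(1) by (metis card_image inj_on_subset)
  have "simple_graph ?H" using c2 sub by (auto simp: simple_graph_def)
  moreover have "f ` e \<subseteq> {..<n}" if "e \<in> edges H" for e
    using sub(1)[OF that] f(2) by blast
  ultimately have "subgraph ?H (complete_graph n)"
    using f(2) c2 by (auto simp: subgraph_def complete_graph_def)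
  moreover have "graph_iso H ?H"
    using f(1) by (auto simp: graph_iso_def bij_betw_def intro!: exI[of _ f])
  moreover have "rainbow c ?H"
    unfolding rainbow_def using f(3) by (auto simp: inj_on_def)
  ultimately show ?L unfolding has_rainbow_copy_def by blast
qed

lemma has_rainbow_copy_embed:
  assumes "simple_graph H" "simple_graph H'"
    and g: "inj_on g (verts H)" "g ` verts H \<subseteq> verts H'" "(\<lambda>e. g ` e) ` edges H \<subseteq> edges H'"
    and "has_rainbow_copy c (complete_graph n) H'"
  shows "has_rainbow_copy c (complete_graph n) H"
proof -
  obtain f where f: "inj_on f (verts H')" "f ` verts H' \<subseteq> {..<n}"
    "inj_on (\<lambda>e. c (f ` e)) (edges H')"
    using assms has_rainbow_copy_iff[of H' c n] by auto
  have "inj_on (f \<circ> g) (verts H)"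
    using g f(1) by (meson comp_inj_on inj_on_subset)
  moreover have "(f \<circ> g) ` verts H \<subseteq> {..<n}" using g(2) f(2) by auto
  moreover have "inj_on (\<lambda>e. g ` e) (edges H)"
    using assms(1)
    by (intro inj_on_subset[OF inj_on_image_Pow[OF g(1)]]) (auto simp: simple_graph_def)
  then have "inj_on ((\<lambda>e. c (f ` e)) \<circ> (\<lambda>e. g ` e)) (edges H)"
    using inj_on_subset[OF f(3) g(3)] by (rule comp_inj_on)
  then have "inj_on (\<lambda>e. c ((f \<circ> g) ` e)) (edges H)"
    by (simp add: o_def image_image)
  ultimately show ?thesis using has_rainbow_copy_iff[OF assms(1)] by blast
qed

section \<open>The matching contained in a union of paths\<close>

lemma edges_path_graph_2: "edges (path_graph 2) = {{0, Suc 0}}"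
  by (auto simp: path_graph_def)

lemma edges_copies_path_graph_2:
  "edges (copies m (path_graph 2)) = (\<lambda>i. {(i, 0), (i, Suc 0)}) ` {..<m}"
  by (auto simp: copies_def edges_path_graph_2)

lemma edges_copies_path_graph:
  "edges (copies m (path_graph l)) =
    (\<lambda>(i, j). {(i, j), (i, Suc j)}) ` ({..<m} \<times> {j. Suc j < l})"
proof -
  have "edges (path_graph l) = (\<lambda>j. {j, Suc j}) ` {j. Suc j < l}" by (auto simp: path_graph_def)
  then have "edges (copies m (path_graph l)) = (\<Union>i<m. (\<lambda>j. {(i, j), (i, Suc j)}) ` {j. Suc j < l})"
    by (simp add: copies_def image_image)
  also have "\<dots> = (\<lambda>(i, j). {(i, j), (i, Suc j)}) ` ({..<m} \<times> {j. Suc j < l})"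
    by (auto simp del: insert_subset)
  finally show ?thesis .
qed

lemma verts_copies_path_graph: "verts (copies m (path_graph l)) = {..<m} \<times> {..<l}"
  by (simp add: copies_def path_graph_def)

lemma edges_disjoint_unionI:
  "a \<in> edges G \<Longrightarrow> Inl ` a \<in> edges (disjoint_union G H)"
  "b \<in> edges H \<Longrightarrow> Inr ` b \<in> edges (disjoint_union G H)"
  by (simp_all add: disjoint_union_def)

text \<open>The first and the last edge of a \<open>P_4\<close> are disjoint, so each path supplies
  two matching edges. This yields the lower bound of the theorem.\<close>

lemma has_rainbow_matching:
  assumes "has_rainbow_copy c (complete_graph n)
    (disjoint_union (copies k (path_graph 4)) (copies t (path_graph 2)))"
  shows "has_rainbow_copy c (complete_graph n) (copies (2 * k + t) (path_graph 2))"
proof (rule has_rainbow_copy_embed[OF _ _ _ _ _ assms])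
  \<comment> \<open>Matching edges \<open>2 * a\<close> and \<open>2 * a + 1\<close> become the
    outer edges of path \<open>a\<close>, on the positions 0, 1 and 2, 3. Those from index
    \<open>2 * k\<close> on become the single edges.\<close>
  let ?g = "\<lambda>(i, j). if i < 2 * k then Inl (i div 2, 2 * (i mod 2) + j) else Inr (i - 2 * k, j)"
  show "inj_on ?g (verts (copies (2 * k + t) (path_graph 2)))"
  proof (rule inj_onI, clarsimp simp: verts_copies_path_graph split: if_splits)
    fix i j i' j' :: nat
    assume "j < 2" "j' < 2" "i div 2 = i' div 2" "2 * (i mod 2) + j = 2 * (i' mod 2) + j'"
    moreover have "a = a' \<and> b = b'" if "2 * a + b = 2 * a' + b'" "b < 2" "b' < 2" for a a' b b' :: nat
      using that by presburger
    ultimately show "i = i' \<and> j = j'" by (metis div_mult_mod_eq)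
  qed arith
  show "?g ` verts (copies (2 * k + t) (path_graph 2))
    \<subseteq> verts (disjoint_union (copies k (path_graph 4)) (copies t (path_graph 2)))"
  proof (clarsimp simp: verts_copies_path_graph disjoint_union_def)
    fix i j :: nat
    assume *: "i < 2 * k + t" "j < 2"
    have "2 * (i mod 2) + j < 4"
      using *(2) mod_less_divisor[of 2 i] by linarith
    moreover have "i div 2 < k" if "i < 2 * k" using that by presburger
    ultimately show "(i < 2 * k \<longrightarrow> Inl (i div 2, 2 * (i mod 2) + j)
        \<in> ({..<k} \<times> {..<4}) <+> ({..<t} \<times> {..<2})) \<and>
      (\<not> i < 2 * k \<longrightarrow> Inr (i - 2 * k, j) \<in> ({..<k} \<times> {..<4}) <+> ({..<t} \<times> {..<2}))"
      using * by auto
  qed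
  show "(\<lambda>e. ?g ` e) ` edges (copies (2 * k + t) (path_graph 2))
    \<subseteq> edges (disjoint_union (copies k (path_graph 4)) (copies t (path_graph 2)))"
  proof (clarsimp simp: edges_copies_path_graph_2)
    fix i assume i: "i < 2 * k + t"
    show "(i < 2 * k \<longrightarrow> {Inl (i div 2, 2 * (i mod 2)), Inl (i div 2, Suc (2 * (i mod 2)))}
        \<in> edges (disjoint_union (copies k (path_graph 4)) (copies t (path_graph 2)))) \<and>
      (\<not> i < 2 * k \<longrightarrow> {Inr (i - 2 * k, 0), Inr (i - 2 * k, Suc 0)}
        \<in> edges (disjoint_union (copies k (path_graph 4)) (copies t (path_graph 2))))"
    proof (intro conjI impI)
      assume "i < 2 * k"
      then have "i div 2 < k" by presburger
      moreover have "Suc (2 * (i mod 2)) < 4" by presburger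
      ultimately have "{(i div 2, 2 * (i mod 2)), (i div 2, Suc (2 * (i mod 2)))}
          \<in> edges (copies k (path_graph 4))"
        unfolding edges_copies_path_graph
        by (intro image_eqI[of _ _ "(i div 2, 2 * (i mod 2))"]) simp_all
      then have "Inl ` {(i div 2, 2 * (i mod 2)), (i div 2, Suc (2 * (i mod 2)))}
          \<in> edges (disjoint_union (copies k (path_graph 4)) (copies t (path_graph 2)))"
        by (rule edges_disjoint_unionI)
      then show "{Inl (i div 2, 2 * (i mod 2)), Inl (i div 2, Suc (2 * (i mod 2)))}
          \<in> edges (disjoint_union (copies k (path_graph 4)) (copies t (path_graph 2)))"
        by simp
    next
      assume "\<not> i < 2 * k"
      then have "{(i - 2 * k, 0), (i - 2 * k, Suc 0)} \<in> edges (copies t (path_graph 2))"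
        unfolding edges_copies_path_graph_2 using i by auto
      then have "Inr ` {(i - 2 * k, 0), (i - 2 * k, Suc 0)}
          \<in> edges (disjoint_union (copies k (path_graph 4)) (copies t (path_graph 2)))"
        by (rule edges_disjoint_unionI)
      then show "{Inr (i - 2 * k, 0), Inr (i - 2 * k, Suc 0)}
          \<in> edges (disjoint_union (copies k (path_graph 4)) (copies t (path_graph 2)))"
        by simp
    qed
  qed
qed (simp_all add: simple_graph_copies simple_graph_disjoint_union simple_graph_path_graph)

section \<open>Rainbow systems of disjoint paths\<close>

fun path_colors :: "('v set \<Rightarrow> 'c) \<Rightarrow> 'v list \<Rightarrow> 'c list" where
  "path_colors c (x # y # xs) = c {x, y} # path_colors c (y # xs)"
| "path_colors c _ = []"

lemma path_colors_append:
  "xs \<noteq> [] \<Longrightarrow> ys \<noteq> [] \<Longrightarrow>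
    path_colors c (xs @ ys) = path_colors c xs @ c {last xs, hd ys} # path_colors c ys"
proof (induction c xs rule: path_colors.induct)
  case ("2_2" c v)
  then show ?case by (cases ys) auto
qed auto

lemma path_colors_rev: "path_colors c (rev xs) = rev (path_colors c xs)"
proof (induction c xs rule: path_colors.induct)
  case (1 c x y xs)
  then show ?case
    using path_colors_append[of "rev xs @ [y]" "[x]" c] by (simp add: insert_commute)
qed auto

lemma length_path_colors: "length (path_colors c xs) = length xs - 1"
  by (induction c xs rule: path_colors.induct) auto

lemma nth_path_colors: "Suc j < length xs \<Longrightarrow> path_colors c xs ! j = c {xs ! j, xs ! Suc j}"
proof (induction c xs arbitrary: j rule: path_colors.induct)
  case (1 c x y xs)
  then show ?case by (cases j) auto
qed auto

text \<open>The set \<open>B\<close> bounds the colors in use, so that a color outside \<open>B\<close> can be used for a new edge.\<close>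

definition rainbow_paths :: "('v set \<Rightarrow> 'c) \<Rightarrow> 'v set \<Rightarrow> 'c set \<Rightarrow> 'v list list \<Rightarrow> bool" where
  "rainbow_paths c V B S \<longleftrightarrow> distinct (concat S) \<and> set (concat S) \<subseteq> V \<and>
     distinct (concat (map (path_colors c) S)) \<and> set (concat (map (path_colors c) S)) \<subseteq> B"

text \<open>All four conditions depend only on the multisets of vertices and of colors. The
  operations below act on the head of the list, and this lemma brings the required paths
  there.\<close>

lemma rainbow_paths_perm:
  assumes "rainbow_paths c V B S" "mset S = mset S'"
  shows "rainbow_paths c V B S'"
proof -
  have *: "mset (concat (map f S)) = mset (concat (map f S'))" for f :: "'a list \<Rightarrow> 'd list"
    using assms(2) by (metis mset_concat mset_map sum_mset_sum_list)
  note 1 = *[of id, simplified] and 2 = *[of "path_colors c"]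
  show ?thesis
    using assms(1) mset_eq_imp_distinct_iff[OF 1] mset_eq_imp_distinct_iff[OF 2]
      mset_eq_setD[OF 1] mset_eq_setD[OF 2]
    unfolding rainbow_paths_def by simp
qed

lemma rainbow_paths_rev: "rainbow_paths c V B (x # S) \<Longrightarrow> rainbow_paths c V B (rev x # S)"
  by (simp add: rainbow_paths_def path_colors_rev)

lemma rainbow_paths_drop: "rainbow_paths c V B (x # S) \<Longrightarrow> rainbow_paths c V B S"
  by (simp add: rainbow_paths_def)

text \<open>The edge between the two parts is given up. Its color may stay in \<open>B\<close>,
  which is only an upper bound.\<close>

lemma rainbow_paths_split:
  assumes "rainbow_paths c V B ((xs @ ys) # S)" "xs \<noteq> []" "ys \<noteq> []"
  shows "rainbow_paths c V B (xs # ys # S)"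
  using assms by (auto simp: rainbow_paths_def path_colors_append)

text \<open>A path with one vertex uses no color. In this form a free vertex can be attached to
  other paths by \<open>rainbow_paths_join\<close>.\<close>

lemma rainbow_paths_singleton:
  assumes "rainbow_paths c V B S" "z \<in> V" "z \<notin> set (concat S)"
  shows "rainbow_paths c V B ([z] # S)"
  using assms by (auto simp: rainbow_paths_def)

text \<open>The bound grows by the new color, so a second join has to use a different one.\<close>

lemma rainbow_paths_join:
  assumes "rainbow_paths c V B (xs # ys # S)" "xs \<noteq> []" "ys \<noteq> []" "c {last xs, hd ys} \<notin> B"
  shows "rainbow_paths c V (insert (c {last xs, hd ys}) B) ((xs @ ys) # S)"
  using assms by (auto simp: rainbow_paths_def path_colors_append)

text \<open>If \<open>u\<close> comes first, the path is reversed; then \<open>u\<close> is ready to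
  be joined to the next path.\<close>

lemma rainbow_paths_orient:
  assumes "rainbow_paths c V B (y # S)" "length y = 2" "u \<in> set y"
  obtains v where "rainbow_paths c V B ([v, u] # S)" "set y = {v, u}"
proof -
  from assms(2) obtain a b where y: "y = [a, b]"
    by (auto simp: numeral_2_eq_2 length_Suc_conv)
  then show ?thesis
    using that assms(1,3) rainbow_paths_rev[OF assms(1)] by auto
qed

text \<open>Turns distinctness of vertices and of colors into the two injectivity claims of
  \<open>has_system_imp_copy\<close>.\<close>

lemma distinct_concat_nth:
  "distinct (concat xss) \<Longrightarrow> i < length xss \<Longrightarrow> i' < length xss \<Longrightarrow> j < length (xss ! i) \<Longrightarrow>
    j' < length (xss ! i') \<Longrightarrow> xss ! i ! j = xss ! i' ! j' \<Longrightarrow> i = i' \<and> j = j'"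
proof (induction xss arbitrary: i i')
  case (Cons xs xss)
  have *: False if "a < length xs" "b < length xss" "d < length (xss ! b)" "xs ! a = xss ! b ! d" for a b d
  proof -
    have "xs ! a \<in> set xs" "xss ! b ! d \<in> set (xss ! b)" "xss ! b \<in> set xss"
      using that(1-3) by (auto intro: nth_mem)
    then show False using Cons.prems(1) that(4) by auto
  qed
  have "distinct (concat xss)" "distinct xs" using Cons.prems(1) by auto
  then show ?case
    using Cons.prems(2-) Cons.IH[of "i - 1" "i' - 1"] *[of j "i' - 1" j'] *[of j' "i - 1" j]
    by (cases i; cases i') (auto simp: nth_eq_iff_index_eq)
qed simp

section \<open>Systems of paths and single edges versus rainbow copies\<close>

definition has_system :: "('v set \<Rightarrow> 'c) \<Rightarrow> 'v set \<Rightarrow> nat \<Rightarrow> nat \<Rightarrow> bool" where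
  "has_system c V p s \<longleftrightarrow> (\<exists>B ps ms. rainbow_paths c V B (ps @ ms) \<and>
     (\<forall>x\<in>set ps. length x = 4) \<and> (\<forall>x\<in>set ms. length x = 2) \<and> length ps = p \<and> length ms = s)"

lemma has_systemI:
  assumes "rainbow_paths c V B S" "mset S = mset (ps @ ms)"
    "\<forall>x\<in>set ps. length x = 4" "\<forall>x\<in>set ms. length x = 2" "length ps = p" "length ms = s"
  shows "has_system c V p s"
  unfolding has_system_def using rainbow_paths_perm[OF assms(1,2)] assms(3-) by blast

lemma has_system_mono:
  assumes "has_system c V p s" "s' \<le> s"
  shows "has_system c V p s'"
proof -
  obtain B ps ms where *: "rainbow_paths c V B (ps @ ms)"
    "\<forall>x\<in>set ps. length x = 4" "\<forall>x\<in>set ms. length x = 2" "length ps = p" "length ms = s"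
    using assms(1) unfolding has_system_def by blast
  have "ms = take s' ms @ drop s' ms" by simp
  then have "rainbow_paths c V B ((ps @ take s' ms) @ drop s' ms)" using *(1) by simp
  then have "rainbow_paths c V B (ps @ take s' ms)"
    unfolding rainbow_paths_def concat_append map_append distinct_append set_append by simp
  then show ?thesis unfolding has_system_def using * assms(2)
    by (intro exI[of _ B] exI[of _ ps] exI[of _ "take s' ms"]) (auto dest: in_set_takeD)
qed

text \<open>Each component is mapped along the list that represents it. Injectivity on vertices and
  injectivity of the colors are both instances of \<open>distinct_concat_nth\<close>, for
  \<open>S\<close> and for \<open>col\<close>.\<close>

lemma has_system_imp_copy:
  assumes "has_system c {..<n} k t"
  shows "has_rainbow_copy c (complete_graph n)
    (disjoint_union (copies k (path_graph 4)) (copies t (path_graph 2)))" (is "has_rainbow_copy _ _ ?H")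
proof -
  obtain B ps ms where rp: "rainbow_paths c {..<n} B (ps @ ms)"
    and len: "\<forall>x\<in>set ps. length x = 4" "\<forall>x\<in>set ms. length x = 2" "length ps = k" "length ms = t"
    using assms unfolding has_system_def by blast
  define S where "S = ps @ ms"
  define f where "f = case_sum (\<lambda>(i, j). S ! i ! j) (\<lambda>(i, j). S ! (k + i) ! j)"
  define col where "col = map (path_colors c) S"
  have S: "distinct (concat S)" "set (concat S) \<subseteq> {..<n}" "distinct (concat col)"
    using rp unfolding rainbow_paths_def S_def col_def by auto
  have lS: "length S = k + t" "length col = k + t" using len by (auto simp: S_def col_def)
  have l4: "length (S ! i) = 4" if "i < k" for i
    using that len by (auto simp: S_def nth_append)
  have l2: "length (S ! (k + i)) = 2" if "i < t" for i
    using that len by (auto simp: S_def nth_append)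
  have lc: "length (col ! i) = length (S ! i) - 1" if "i < k + t" for i
    using that lS by (simp add: col_def length_path_colors)
  have cn: "c {S ! i ! j, S ! i ! Suc j} = col ! i ! j" if "i < k + t" "Suc j < length (S ! i)" for i j
    using that lS by (simp add: col_def nth_path_colors)
  have nS: "S ! i ! j \<in> {..<n}" if "i < k + t" "j < length (S ! i)" for i j
  proof -
    have "S ! i \<in> set S" "S ! i ! j \<in> set (S ! i)" using that lS by simp_all
    then show ?thesis using S(2) by auto
  qed
  have simple: "simple_graph ?H"
    by (simp add: simple_graph_copies simple_graph_disjoint_union simple_graph_path_graph)
  have "inj_on f (verts ?H)"
  proof (rule inj_onI)
    \<comment> \<open>The position of a vertex: the index of its path in \<open>S\<close>, shifted
      by \<open>k\<close> for the single edges, and the index within that path.\<close>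
    define pos where "pos = case_sum (\<lambda>(i :: nat, j :: nat). (i, j)) (\<lambda>(i, j). (k + i, j))"
    have pos: "f v = S ! fst (pos v) ! snd (pos v)" "fst (pos v) < length S"
      "snd (pos v) < length (S ! fst (pos v))" if "v \<in> verts ?H" for v
      using that lS l4 l2
      by (auto simp: disjoint_union_def verts_copies_path_graph f_def pos_def)
    fix v w assume vw: "v \<in> verts ?H" "w \<in> verts ?H" and "f v = f w"
    then have "pos v = pos w"
      using distinct_concat_nth[OF S(1), of "fst (pos v)" "fst (pos w)" "snd (pos v)" "snd (pos w)"]
        pos[of v] pos[of w] by (simp add: prod_eq_iff)
    then show "v = w"
      using vw by (auto simp: disjoint_union_def verts_copies_path_graph pos_def)
  qed
  moreover have "f ` verts ?H \<subseteq> {..<n}"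
  proof
    fix y assume "y \<in> f ` verts ?H"
    then consider i j where "i < k" "j < 4" "y = S ! i ! j" | i j where "i < t" "j < 2" "y = S ! (k + i) ! j"
      unfolding disjoint_union_def verts_copies_path_graph f_def by auto
    then show "y \<in> {..<n}"
    proof cases
      case 1
      then show ?thesis using nS[of i j] l4[of i] by simp
    next
      case 2
      then show ?thesis using nS[of "k + i" j] l2[of i] by simp
    qed
  qed
  moreover have "inj_on (\<lambda>e. c (f ` e)) (edges ?H)"
  proof (rule inj_onI)
    \<comment> \<open>The color of an edge stands at some position \<open>(i, j)\<close> of
      \<open>col\<close>, and this position determines the edge.\<close>
    have E: "\<exists>i j. i < k + t \<and> j < length (col ! i) \<and> c (f ` e) = col ! i ! j \<and>
      e = (if i < k then Inl ` {(i, j), (i, Suc j)} else Inr ` {(i - k, j), (i - k, Suc j)})"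
      if e: "e \<in> edges ?H" for e
    proof -
      consider a where "a \<in> edges (copies k (path_graph 4))" "e = Inl ` a"
        | a where "a \<in> edges (copies t (path_graph 2))" "e = Inr ` a"
        using e unfolding disjoint_union_def by auto
      then consider i j where "i < k" "Suc j < 4" "e = Inl ` {(i, j), (i, Suc j)}"
        | i where "i < t" "e = Inr ` {(i, 0), (i, Suc 0)}"
        by cases (auto simp: edges_copies_path_graph edges_copies_path_graph_2)
      then show ?thesis
      proof cases
        case 1
        then show ?thesis
          using cn[of i j] l4[of i] lc[of i] by (intro exI[of _ i] exI[of _ j]) (auto simp: f_def)
      next
        case 2
        then show ?thesis
          using cn[of "k + i" 0] l2[of i] lc[of "k + i"]
          by (intro exI[of _ "k + i"] exI[of _ 0]) (auto simp: f_def)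
      qed
    qed
    fix e e' assume "e \<in> edges ?H" "e' \<in> edges ?H" and eq: "c (f ` e) = c (f ` e')"
    from E[OF this(1)] obtain i j where 1: "i < k + t" "j < length (col ! i)" "c (f ` e) = col ! i ! j"
      "e = (if i < k then Inl ` {(i, j), (i, Suc j)} else Inr ` {(i - k, j), (i - k, Suc j)})" by blast
    from E[OF \<open>e' \<in> _\<close>] obtain i' j' where 2: "i' < k + t" "j' < length (col ! i')" "c (f ` e') = col ! i' ! j'"
      "e' = (if i' < k then Inl ` {(i', j'), (i', Suc j')} else Inr ` {(i' - k, j'), (i' - k, Suc j')})" by blast
    have "i = i' \<and> j = j'"
      using distinct_concat_nth[OF S(3), of i i' j j'] 1(1-3) 2(1-3) eq lS by simp
    then show "e = e'" using 1(4) 2(4) by simp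
  qed
  ultimately show ?thesis using has_rainbow_copy_iff[OF simple] by blast
qed

lemma copy_imp_has_system:
  assumes "has_rainbow_copy c (complete_graph n) (copies m (path_graph 2))"
  shows "has_system c {..<n} 0 m"
proof -
  obtain f where f: "inj_on f ({..<m} \<times> {..<2})" "f ` ({..<m} \<times> {..<2}) \<subseteq> {..<n}"
    "inj_on (\<lambda>e. c (f ` e)) ((\<lambda>i. {(i, 0), (i, Suc 0)}) ` {..<m})"
    using assms has_rainbow_copy_iff[OF simple_graph_copies[OF simple_graph_path_graph], of c n m 2]
    by (auto simp: edges_copies_path_graph_2 verts_copies_path_graph)
  define ms where "ms = map (\<lambda>i. [f (i, 0), f (i, Suc 0)]) [0..<m]"
  have f_eq: "f (i, j) = f (i', j') \<longleftrightarrow> i = i' \<and> j = j'" if "i < m" "i' < m" "j < 2" "j' < 2" for i i' j j'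
    using inj_on_eq_iff[OF f(1), of "(i, j)" "(i', j')"] that by simp
  have "distinct (concat (map (\<lambda>i. [f (i, 0), f (i, Suc 0)]) is))"
    if "set is \<subseteq> {..<m}" "distinct is" for "is"
    using that by (induction "is") (auto simp: f_eq)
  then have d: "distinct (concat ms)" unfolding ms_def by (simp add: atLeast0LessThan)
  have "inj_on (\<lambda>i. {(i, 0), (i, Suc 0)}) {..<m}" by (auto simp: inj_on_def doubleton_eq_iff)
  then have "inj_on (\<lambda>i. c (f ` {(i, 0), (i, Suc 0)})) {..<m}"
    using comp_inj_on[OF _ f(3)] unfolding o_def by blast
  moreover have "concat (map (path_colors c) ms) = map (\<lambda>i. c (f ` {(i, 0), (i, Suc 0)})) [0..<m]"
    unfolding ms_def by (simp add: o_def)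
  ultimately have "distinct (concat (map (path_colors c) ms))"
    by (simp add: distinct_map atLeast0LessThan)
  moreover have "set (concat ms) \<subseteq> {..<n}"
    using f(2) unfolding ms_def by force
  \<comment> \<open>No color has to be kept free here, so \<open>UNIV\<close> serves as the
    bound.\<close>
  ultimately have "rainbow_paths c {..<n} UNIV ([] @ ms)" using d by (simp add: rainbow_paths_def)
  then show ?thesis unfolding has_system_def
    by (intro exI[of _ UNIV] exI[of _ "[]"] exI[of _ ms]) (auto simp: ms_def)
qed

section \<open>Counting unused colors around a maximal system\<close>

lemma obtain_Cons_perm:
  assumes "x \<in> set xs"
  obtains xs' where "mset xs = add_mset x (mset xs')" "set xs = insert x (set xs')"
    "length xs = Suc (length xs')"
proof -
  obtain as bs where "xs = as @ x # bs" using split_list[OF assms] by blast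
  then show ?thesis by (intro that[of "as @ bs"]) auto
qed

lemma distinct_concat_disjoint:
  assumes "distinct (concat xss)" "xs \<in> set xss" "ys \<in> set xss" "v \<in> set xs" "v \<in> set ys"
  shows "xs = ys"
  using assms by (metis disjoint_iff distinct_concat_iff)

text \<open>The set \<open>F\<close> contains one edge of each color that the system does not use.\<close>

locale maximal_system =
  fixes c :: "'v set \<Rightarrow> 'c" and V :: "'v set" and ps ms :: "'v list list" and B :: "'c set"
    and F :: "'v set set"
  assumes finite_V: "finite V"
    and rainbow: "rainbow_paths c V B (ps @ ms)"
    and length_ps: "x \<in> set ps \<Longrightarrow> length x = 4"
    and length_ms: "y \<in> set ms \<Longrightarrow> length y = 2"
    and two_le: "2 \<le> length ms"
    and no_more_paths: "\<not> has_system c V (Suc (length ps)) (length ms - 2)"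
    and no_more_edges: "\<not> has_system c V (length ps) (Suc (length ms))"
    and F_edges: "e \<in> F \<Longrightarrow> e \<subseteq> V \<and> card e = 2"
    and F_inj: "inj_on c F"
    and F_new: "e \<in> F \<Longrightarrow> c e \<notin> B"
    and B_used: "B = set (concat (map (path_colors c) (ps @ ms)))"
begin

definition V4 where "V4 = set (concat ps)"
definition V2 where "V2 = set (concat ms)"
definition R where "R = V - V4 - V2"

lemma distinct_ps: "distinct (concat ps)" and distinct_ms: "distinct (concat ms)"
  and disjoint_V4_V2: "V4 \<inter> V2 = {}" and V4_V: "V4 \<subseteq> V" and V2_V: "V2 \<subseteq> V"
  using rainbow by (auto simp: rainbow_paths_def V4_def V2_def)

lemma finite_V4: "finite V4" and finite_V2: "finite V2" and finite_R: "finite R"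
  using finite_V by (auto simp: V4_def V2_def R_def)

section \<open>Reroutings that would enlarge the system\<close>

lemma F_neq: "{u, v} \<in> F \<Longrightarrow> u \<noteq> v"
  using F_edges[of "{u, v}"] by auto

text \<open>The form in which the reroutings contradict maximality: order of the list and bound on
  the colors are arbitrary, and surplus matching edges are discarded by
  \<open>has_system_mono\<close>.\<close>

lemma no_more_paths': "rainbow_paths c V B' S \<Longrightarrow> mset S = mset (qs @ ms') \<Longrightarrow>
    \<forall>x\<in>set qs. length x = 4 \<Longrightarrow> \<forall>x\<in>set ms'. length x = 2 \<Longrightarrow>
    length qs = Suc (length ps) \<Longrightarrow> length ms - 2 \<le> length ms' \<Longrightarrow> False"
  using no_more_paths has_system_mono[OF has_systemI[of c V B' S qs ms' "Suc (length ps)" "length ms'"]]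
  by blast

text \<open>Orients two matching edges so that \<open>u\<close> and \<open>u'\<close> face each
  other, ready to be joined directly or through a further vertex.\<close>

lemma two_edges:
  assumes "y \<in> set ms" "y' \<in> set ms" "y \<noteq> y'" "u \<in> set y" "u' \<in> set y'"
  obtains v v' ms' where "rainbow_paths c V B ([v, u] # [u', v'] # ps @ ms')"
    "mset ms = mset (y # y' # ms')" "\<forall>x\<in>set ms'. length x = 2" "length ms' = length ms - 2"
    "set y = {v, u}" "set y' = {u', v'}"
proof -
  obtain ms1 where 1: "mset ms = add_mset y (mset ms1)" "set ms = insert y (set ms1)"
    "length ms = Suc (length ms1)"
    using obtain_Cons_perm[OF assms(1)] .
  then have "y' \<in> set ms1" using assms(2,3) by simp
  then obtain ms' where 2: "mset ms1 = add_mset y' (mset ms')" "set ms1 = insert y' (set ms')"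
    "length ms1 = Suc (length ms')"
    using obtain_Cons_perm by metis
  have m: "mset ms = mset (y # y' # ms')" using 1 2 by simp
  have "rainbow_paths c V B (y # y' # ps @ ms')"
    by (rule rainbow_paths_perm[OF rainbow]) (simp add: m)
  from rainbow_paths_orient[OF this length_ms[OF assms(1)] assms(4)] obtain v where
    3: "rainbow_paths c V B ([v, u] # y' # ps @ ms')" and v: "set y = {v, u}" .
  from 3 have "rainbow_paths c V B (y' # [v, u] # ps @ ms')" by (rule rainbow_paths_perm) simp
  from rainbow_paths_orient[OF this length_ms[OF assms(2)] assms(5)] obtain v' where
    4: "rainbow_paths c V B ([v', u'] # [v, u] # ps @ ms')" and v': "set y' = {v', u'}" .
  from rainbow_paths_rev[OF 4]
  have "rainbow_paths c V B ([u', v'] # [v, u] # ps @ ms')" by simp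
  then have "rainbow_paths c V B ([v, u] # [u', v'] # ps @ ms')" by (rule rainbow_paths_perm) simp
  moreover have "\<forall>x\<in>set ms'. length x = 2" using length_ms 1(2) 2(2) by simp
  moreover have "length ms' = length ms - 2" using 1(3) 2(3) by simp
  ultimately show ?thesis
    using v' by (intro that[OF _ m _ _ v]) (simp_all only: insert_commute[of v' u'])
qed

text \<open>Within one matching edge, the edge would be the matching edge itself, whose color is in
  \<open>B\<close>. Between two matching edges it would complete them to a \<open>P_4\<close>, at
  the cost of just these two.\<close>

lemma F_no_V2_V2:
  assumes "u \<in> V2" "u' \<in> V2"
  shows "{u, u'} \<notin> F"
proof
  assume F: "{u, u'} \<in> F"
  obtain y y' where y: "y \<in> set ms" "y' \<in> set ms" "u \<in> set y" "u' \<in> set y'"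
    using assms by (auto simp: V2_def)
  show False
  proof (cases "y = y'")
    case True
    obtain a b where ab: "y = [a, b]"
      using length_ms[OF y(1)] by (auto simp: numeral_2_eq_2 length_Suc_conv)
    have "{u, u'} = {a, b}" using y ab F_neq[OF F] True by auto
    moreover have "c {a, b} \<in> B"
      using y(1) ab unfolding B_used by (auto intro!: bexI[of _ y])
    ultimately show False using F_new[OF F] by simp
  next
    case False
    from two_edges[OF y(1,2) False y(3,4)] obtain v v' ms' where *:
      "rainbow_paths c V B ([v, u] # [u', v'] # ps @ ms')"
      "\<forall>x\<in>set ms'. length x = 2" "length ms' = length ms - 2" .
    from rainbow_paths_join[OF *(1)] F_new[OF F]
    have "rainbow_paths c V (insert (c {u, u'}) B) ([v, u, u', v'] # ps @ ms')" by simp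
    then show False
      by (rule no_more_paths'[of _ _ "[v, u, u', v'] # ps" ms']) (use * length_ps in auto)
  qed
qed

text \<open>Such an edge could be added to the matching.\<close>

lemma F_no_R_R:
  assumes "z \<in> R" "z' \<in> R"
  shows "{z, z'} \<notin> F"
proof
  assume F: "{z, z'} \<in> F"
  have "rainbow_paths c V B ([z'] # ps @ ms)"
    using assms by (intro rainbow_paths_singleton[OF rainbow]) (auto simp: R_def V4_def V2_def)
  then have "rainbow_paths c V B ([z] # [z'] # ps @ ms)"
    using assms F_neq[OF F]
    by (intro rainbow_paths_singleton[of _ _ _ "[z'] # ps @ ms"]) (auto simp: R_def V4_def V2_def)
  from rainbow_paths_join[OF this] F_new[OF F]
  have "rainbow_paths c V (insert (c {z, z'}) B) ([z, z'] # ps @ ms)" by simp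
  then have "has_system c V (length ps) (Suc (length ms))"
    by (rule has_systemI[of _ _ _ _ ps "[z, z'] # ms"]) (use length_ps length_ms in auto)
  then show False using no_more_edges by simp
qed

text \<open>Otherwise \<open>v, u, z, u', v'\<close> is a rainbow path on five vertices, and it
  contains a \<open>P_4\<close> that costs only two matching edges.\<close>

lemma F_R_same_edge:
  assumes "z \<in> R" "{u, z} \<in> F" "{u', z} \<in> F" "y \<in> set ms" "y' \<in> set ms" "u \<in> set y" "u' \<in> set y'"
  shows "y = y'"
proof (rule ccontr)
  assume "y \<noteq> y'"
  from two_edges[OF assms(4,5) this assms(6,7)] obtain v v' ms' where *:
    "rainbow_paths c V B ([v, u] # [u', v'] # ps @ ms')" "mset ms = mset (y # y' # ms')"
    "\<forall>x\<in>set ms'. length x = 2" "length ms' = length ms - 2"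
    "set y = {v, u}" "set y' = {u', v'}" .
  have "u \<noteq> u'"
    using distinct_concat_disjoint[OF distinct_ms assms(4,5)] assms(6,7) \<open>y \<noteq> y'\<close> by auto
  then have "{u, z} \<noteq> {u', z}" by (auto simp: doubleton_eq_iff)
  then have ne: "c {u, z} \<noteq> c {z, u'}"
    using inj_onD[OF F_inj _ assms(2,3)] by (auto simp: insert_commute)
  have S: "set (concat ([v, u] # [u', v'] # ps @ ms')) \<subseteq> V4 \<union> V2"
    using mset_eq_setD[OF *(2)] *(5,6) by (auto simp: V4_def V2_def)
  have "rainbow_paths c V B ([z] # [v, u] # [u', v'] # ps @ ms')"
    using assms(1) S by (intro rainbow_paths_singleton[OF *(1)]) (auto simp: R_def)
  then have "rainbow_paths c V B ([v, u] # [z] # [u', v'] # ps @ ms')"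
    by (rule rainbow_paths_perm) simp
  from rainbow_paths_join[OF this] F_new[OF assms(2)]
  have "rainbow_paths c V (insert (c {u, z}) B) ([v, u, z] # [u', v'] # ps @ ms')" by simp
  from rainbow_paths_join[OF this] F_new[OF assms(3)] ne
  have "rainbow_paths c V (insert (c {z, u'}) (insert (c {u, z}) B)) ([v, u, z, u', v'] # ps @ ms')"
    by (simp add: insert_commute)
  \<comment> \<open>Cutting off \<open>v\<close> shortens the path to the required four
    vertices.\<close>
  then have "rainbow_paths c V (insert (c {z, u'}) (insert (c {u, z}) B)) ([v] # [u, z, u', v'] # ps @ ms')"
    using rainbow_paths_split[of c V _ "[v]" "[u, z, u', v']"] by simp
  then show False
    by (rule no_more_paths'[OF rainbow_paths_drop, of _ _ _ "[u, z, u', v'] # ps" ms'])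
      (use * length_ps in auto)
qed

text \<open>Deleting the middle edge leaves two halves. Each is oriented so that the vertex to be
  extended, \<open>w\<close> or \<open>w'\<close>, is at the outer end of the pair of lists.\<close>

lemma split_path:
  assumes "x \<in> set ps" "w \<in> {x ! 0, x ! 1}" "w' \<in> {x ! 2, x ! 3}"
  obtains v v' ps' where "rainbow_paths c V B ([w, v] # [v', w'] # ps' @ ms)"
    "length ps' = length ps - 1" "\<forall>x\<in>set ps'. length x = 4"
proof -
  obtain a b d e where x: "x = [a, b, d, e]"
    using length_ps[OF assms(1)] by (auto simp: numeral_eq_Suc length_Suc_conv)
  obtain ps' where m: "mset ps = add_mset x (mset ps')" "set ps = insert x (set ps')"
    "length ps = Suc (length ps')"
    using obtain_Cons_perm[OF assms(1)] .
  have 0: "rainbow_paths c V B (x # ps' @ ms)"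
    by (rule rainbow_paths_perm[OF rainbow]) (simp add: m)
  then have "rainbow_paths c V B ([a, b] # [d, e] # ps' @ ms)"
    using rainbow_paths_split[of c V B "[a, b]" "[d, e]"] x by simp
  then have "\<exists>v. rainbow_paths c V B ([w, v] # [d, e] # ps' @ ms)"
    using assms(2) x rainbow_paths_rev[of c V B "[a, b]"] by auto
  then obtain v where "rainbow_paths c V B ([w, v] # [d, e] # ps' @ ms)" by blast
  then have "rainbow_paths c V B ([d, e] # [w, v] # ps' @ ms)" by (rule rainbow_paths_perm) simp
  then have "\<exists>v'. rainbow_paths c V B ([v', w'] # [w, v] # ps' @ ms)"
    using assms(3) x rainbow_paths_rev[of c V B "[d, e]"] by auto
  then obtain v' where "rainbow_paths c V B ([v', w'] # [w, v] # ps' @ ms)" by blast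
  then have "rainbow_paths c V B ([w, v] # [v', w'] # ps' @ ms)" by (rule rainbow_paths_perm) simp
  moreover have "\<forall>x\<in>set ps'. length x = 4" using length_ps m(2) by simp
  moreover have "length ps' = length ps - 1" using m(3) by simp
  ultimately show ?thesis using that by blast
qed

text \<open>The two halves of a path can be extended by two edges of the matching.\<close>

lemma F_halves_same_edge:
  assumes x: "x \<in> set ps" and w: "w \<in> {x ! 0, x ! 1}" "w' \<in> {x ! 2, x ! 3}"
    and y: "y \<in> set ms" "y' \<in> set ms" "u \<in> set y" "u' \<in> set y'"
    and F: "{w, u} \<in> F" "{w', u'} \<in> F"
  shows "y = y'"
proof (rule ccontr)
  assume "y \<noteq> y'"
  from two_edges[OF y(1,2) this y(3,4)] obtain v v' ms' where m:
    "mset ms = mset (y # y' # ms')"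
    "\<forall>x\<in>set ms'. length x = 2" "length ms' = length ms - 2" .
  have "u \<noteq> u'"
    using distinct_concat_disjoint[OF distinct_ms y(1,2)] y(3,4) \<open>y \<noteq> y'\<close> by auto
  moreover have "w \<in> set x" "w' \<in> set x" using w length_ps[OF x] by auto
  then have "w \<in> V4" "w' \<in> V4" using x by (auto simp: V4_def)
  moreover have "u \<in> V2" "u' \<in> V2" using y by (auto simp: V2_def)
  ultimately have "{w, u} \<noteq> {w', u'}" using disjoint_V4_V2 by (auto simp: doubleton_eq_iff)
  then have ne: "c {w, u} \<noteq> c {w', u'}" using inj_onD[OF F_inj _ F] by auto
  obtain q q' ps' where q: "rainbow_paths c V B ([w, q] # [q', w'] # ps' @ ms)"
    "length ps' = length ps - 1" "\<forall>x\<in>set ps'. length x = 4"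
    using split_path[OF x w] .
  have "rainbow_paths c V B (y # y' # [w, q] # [q', w'] # ps' @ ms')"
    by (rule rainbow_paths_perm[OF q(1)]) (simp add: m)
  from rainbow_paths_orient[OF this length_ms[OF y(1)] y(3)] obtain v where
    "rainbow_paths c V B ([v, u] # y' # [w, q] # [q', w'] # ps' @ ms')" .
  then have "rainbow_paths c V B (y' # [v, u] # [w, q] # [q', w'] # ps' @ ms')"
    by (rule rainbow_paths_perm) simp
  from rainbow_paths_orient[OF this length_ms[OF y(2)] y(4)] obtain v' where
    "rainbow_paths c V B ([v', u'] # [v, u] # [w, q] # [q', w'] # ps' @ ms')" .
  from rainbow_paths_rev[OF this]
  have "rainbow_paths c V B ([u', v'] # [v, u] # [w, q] # [q', w'] # ps' @ ms')" by simp
  then have "rainbow_paths c V B ([v, u] # [w, q] # [q', w'] # [u', v'] # ps' @ ms')"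
    by (rule rainbow_paths_perm) simp
  \<comment> \<open>The two joins produce \<open>v, u, w, q\<close> and
    \<open>q', w', u', v'\<close>: two paths in place of \<open>x\<close> and two matching
    edges.\<close>
  from rainbow_paths_join[OF this] F_new[OF F(1)]
  have "rainbow_paths c V (insert (c {w, u}) B) ([v, u, w, q] # [q', w'] # [u', v'] # ps' @ ms')"
    by (simp add: insert_commute)
  then have "rainbow_paths c V (insert (c {w, u}) B) ([q', w'] # [u', v'] # [v, u, w, q] # ps' @ ms')"
    by (rule rainbow_paths_perm) simp
  from rainbow_paths_join[OF this] F_new[OF F(2)] ne
  have "rainbow_paths c V (insert (c {w', u'}) (insert (c {w, u}) B))
      ([q', w', u', v'] # [v, u, w, q] # ps' @ ms')"
    by simp
  moreover have "length ps \<ge> 1" using x by (cases ps) auto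
  ultimately show False
    by (intro no_more_paths'[of _ _ "[q', w', u', v'] # [v, u, w, q] # ps'" ms'])
      (use m(2,3) q in auto)
qed

text \<open>With four such vertices, the paths \<open>z1, a, z2, b\<close> and
  \<open>z3, d, z4, e\<close> could replace \<open>x = [a, b, d, e]\<close>, a gain of one
  \<open>P_4\<close> without loss of matching edges.\<close>

lemma F_full_le_3:
  assumes x: "x \<in> set ps"
  shows "card {z \<in> R. \<forall>v\<in>set x. {v, z} \<in> F} \<le> 3"
proof (rule ccontr)
  let ?Z = "{z \<in> R. \<forall>v\<in>set x. {v, z} \<in> F}"
  assume "\<not> ?thesis"
  then obtain Z where Z: "Z \<subseteq> ?Z" "card Z = 4" "finite Z"
    using obtain_subset_with_card_n[of 4 ?Z] by auto
  obtain zs where zs: "set zs = Z" "distinct zs" using finite_distinct_list[OF Z(3)] by blast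
  have "length zs = 4" using distinct_card[OF zs(2)] zs(1) Z(2) by simp
  then obtain z1 z2 z3 z4 where z: "zs = [z1, z2, z3, z4]"
    by (auto simp: numeral_eq_Suc length_Suc_conv)
  obtain a b d e where abde: "x = [a, b, d, e]"
    using length_ps[OF x] by (auto simp: numeral_eq_Suc length_Suc_conv)
  have F: "{v, z} \<in> F" if "v \<in> {a, b, d, e}" "z \<in> {z1, z2, z3, z4}" for v z
    using that subsetD[OF Z(1), of z] zs(1) z abde by auto
  have zR: "z \<in> R" if "z \<in> {z1, z2, z3, z4}" for z
    using that subsetD[OF Z(1), of z] zs(1) z by auto
  obtain ps' where m: "mset ps = add_mset x (mset ps')" "set ps = insert x (set ps')"
    "length ps = Suc (length ps')"
    using obtain_Cons_perm[OF x] .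
  have 0: "rainbow_paths c V B ([a, b, d, e] # ps' @ ms)"
    by (rule rainbow_paths_perm[OF rainbow]) (simp add: m abde )
  have d: "distinct [z1, z2, z3, z4]" "distinct [a, b, d, e]"
    using zs z 0 by (auto simp: rainbow_paths_def)
  have "set (concat (ps' @ ms)) \<subseteq> V4 \<union> V2"
    using m(2) by (auto simp: V4_def V2_def)
  moreover have xV4: "set x \<subseteq> V4" using x by (auto simp: V4_def)
  ultimately have out: "z \<notin> set (concat (ps' @ ms))" "z \<notin> {a, b, d, e}" "z \<in> V"
    if "z \<in> {z1, z2, z3, z4}" for z
    using zR[OF that] abde by (auto simp: R_def)
  have col: "c {v, z} = c {v', z'} \<longleftrightarrow> v = v' \<and> z = z'"
    if "v \<in> {a, b, d, e}" "z \<in> {z1, z2, z3, z4}" "v' \<in> {a, b, d, e}" "z' \<in> {z1, z2, z3, z4}" for v z v' z'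
    using inj_on_eq_iff[OF F_inj F[OF that(1,2)] F[OF that(3,4)]] out[OF that(2)] out[OF that(4)] that
    by (auto simp: doubleton_eq_iff)
  \<comment> \<open>All six new edges enter at once, so the bound is enlarged by every color of
    \<open>F\<close> instead of one join at a time.\<close>
  let ?B = "B \<union> c ` F"
  have "rainbow_paths c V ?B ([z1, a, z2, b] # [z3, d, z4, e] # ps' @ ms)"
  proof -
    have nB: "c {v, z} \<notin> B" if "v \<in> {a, b, d, e}" "z \<in> {z1, z2, z3, z4}" for v z
      using F_new F[OF that] by blast
    have colors: "path_colors c [z1, a, z2, b] = [c {a, z1}, c {a, z2}, c {b, z2}]"
      "path_colors c [z3, d, z4, e] = [c {d, z3}, c {d, z4}, c {e, z4}]"
      by (simp_all add: insert_commute)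
    have T: "rainbow_paths c V B (ps' @ ms)" using 0 by (rule rainbow_paths_drop)
    have abV: "set [a, b, d, e] \<subseteq> V" "set [a, b, d, e] \<inter> set (concat (ps' @ ms)) = {}"
      using 0 by (auto simp: rainbow_paths_def)
    let ?C = "[c {a, z1}, c {a, z2}, c {b, z2}, c {d, z3}, c {d, z4}, c {e, z4}]"
    have "distinct ?C" using d by (simp add: col)
    moreover have "set ?C \<inter> B = {}" using nB by simp
    moreover have "set ?C \<subseteq> c ` F" using F by simp
    moreover have "distinct [z1, a, z2, b, z3, d, z4, e]" using d out by auto
    moreover have "set [z1, a, z2, b, z3, d, z4, e] \<inter> set (concat (ps' @ ms)) = {}"
      using abV(2) out(1) by auto
    moreover have "set [z1, a, z2, b, z3, d, z4, e] \<subseteq> V" using abV(1) out(3) by auto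
    ultimately have
      "distinct ([z1, a, z2, b, z3, d, z4, e] @ concat (ps' @ ms))"
      "set ([z1, a, z2, b, z3, d, z4, e] @ concat (ps' @ ms)) \<subseteq> V"
      "distinct (?C @ concat (map (path_colors c) (ps' @ ms)))"
      "set (?C @ concat (map (path_colors c) (ps' @ ms))) \<subseteq> ?B"
      using T unfolding rainbow_paths_def distinct_append set_append by blast+
    then show ?thesis
      unfolding rainbow_paths_def list.map concat.simps colors by simp
  qed
  moreover have "length ps \<ge> 1" using x by (cases ps) auto
  moreover have "\<forall>x\<in>set ps'. length x = 4" using length_ps m(2) by simp
  ultimately show False
    by (intro no_more_paths'[of _ _ "[z1, a, z2, b] # [z3, d, z4, e] # ps'" ms])
      (use m(3) length_ms in auto)
qed

section \<open>Counting the edges of \<open>F\<close>\<close>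

definition cross :: "'v set \<Rightarrow> 'v set \<Rightarrow> ('v \<times> 'v) set" where
  "cross X Y = {(u, v) \<in> X \<times> Y. {u, v} \<in> F}"

lemma cross_subset: "cross X Y \<subseteq> X \<times> Y"
  by (auto simp: cross_def)

lemma finite_cross: "finite X \<Longrightarrow> finite Y \<Longrightarrow> finite (cross X Y)"
  by (rule finite_subset[OF cross_subset]) simp

lemma card_cross_le: "finite X \<Longrightarrow> finite Y \<Longrightarrow> card (cross X Y) \<le> card X * card Y"
  using card_mono[OF _ cross_subset, of X Y] by (simp add: card_cartesian_product)

lemma card_cross_eq_sum:
  assumes "finite X" "finite Y"
  shows "card (cross X Y) = (\<Sum>z\<in>Y. card {u \<in> X. {u, z} \<in> F})"
proof -
  have "cross X Y = (\<lambda>(z, u). (u, z)) ` (SIGMA z:Y. {u \<in> X. {u, z} \<in> F})"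
    by (auto simp: cross_def)
  then have "card (cross X Y) = card (SIGMA z:Y. {u \<in> X. {u, z} \<in> F})"
    by (simp add: card_image inj_on_def split_beta prod_eq_iff)
  then show ?thesis using assms by simp
qed

lemma card_set_ps: "x \<in> set ps \<Longrightarrow> card (set x) = 4"
  using distinct_ps length_ps distinct_card[of x] by (simp add: distinct_concat_iff)

lemma card_set_ms: "y \<in> set ms \<Longrightarrow> card (set y) = 2"
  using distinct_ms length_ms distinct_card[of y] by (simp add: distinct_concat_iff)

lemma card_V4: "card V4 = 4 * length ps"
proof -
  have "sum_list (map length ps) = sum_list (map (\<lambda>_. 4) ps)"
    using length_ps by (intro arg_cong[of _ _ sum_list] map_cong) auto
  then show ?thesis
    unfolding V4_def distinct_card[OF distinct_ps] length_concat by (simp add: sum_list_triv)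
qed

lemma card_V2: "card V2 = 2 * length ms"
proof -
  have "sum_list (map length ms) = sum_list (map (\<lambda>_. 2) ms)"
    using length_ms by (intro arg_cong[of _ _ sum_list] map_cong) auto
  then show ?thesis
    unfolding V2_def distinct_card[OF distinct_ms] length_concat by (simp add: sum_list_triv)
qed

lemma card_V: "card V = 4 * length ps + 2 * length ms + card R"
proof -
  have "V = (V4 \<union> V2) \<union> R" "(V4 \<union> V2) \<inter> R = {}" using V4_V V2_V by (auto simp: R_def)
  then have "card V = card (V4 \<union> V2) + card R"
    using card_Un_disjoint[of "V4 \<union> V2" R] finite_V4 finite_V2 finite_R by simp
  then show ?thesis
    using card_Un_disjoint[OF finite_V4 finite_V2 disjoint_V4_V2] card_V4 card_V2 by simp
qed

text \<open>By \<open>F_R_same_edge\<close>, all neighbors in \<open>V2\<close> of a vertex of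
  \<open>R\<close> lie on one matching edge.\<close>

lemma card_cross_V2_R: "card (cross V2 R) \<le> 2 * card R"
proof -
  have "card {u \<in> V2. {u, z} \<in> F} \<le> 2" if z: "z \<in> R" for z
  proof (cases "{u \<in> V2. {u, z} \<in> F} = {}")
    case False
    then obtain u y where u: "{u, z} \<in> F" "y \<in> set ms" "u \<in> set y"
      by (auto simp: V2_def)
    have "{u \<in> V2. {u, z} \<in> F} \<subseteq> set y"
      using F_R_same_edge[OF z u(1) _ u(2) _ u(3)] by (auto simp: V2_def)
    then have "card {u \<in> V2. {u, z} \<in> F} \<le> card (set y)" by (intro card_mono) auto
    then show ?thesis using card_set_ms[OF u(2)] by simp
  next
    case True
    show ?thesis unfolding True by simp
  qed
  then have "(\<Sum>z\<in>R. card {u \<in> V2. {u, z} \<in> F}) \<le> (\<Sum>z\<in>R. 2)" by (rule sum_mono)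
  then show ?thesis using card_cross_eq_sum[OF finite_V2 finite_R] by simp
qed

text \<open>A vertex of \<open>R\<close> is joined to at most three vertices of \<open>x\<close>,
  apart from at most three exceptions by \<open>F_full_le_3\<close>, which contribute one more
  each.\<close>

lemma card_cross_path_R:
  assumes x: "x \<in> set ps"
  shows "card (cross (set x) R) \<le> 3 * card R + 3"
proof -
  let ?full = "{z \<in> R. \<forall>v\<in>set x. {v, z} \<in> F}"
  have "card {u \<in> set x. {u, z} \<in> F} \<le> 3 + of_bool (z \<in> ?full)" if z: "z \<in> R" for z
  proof (cases "z \<in> ?full")
    case True
    have "card {u \<in> set x. {u, z} \<in> F} \<le> card (set x)" by (intro card_mono) auto
    then show ?thesis using True card_set_ps[OF x] by simp
  next
    case False
    then have "{u \<in> set x. {u, z} \<in> F} \<subset> set x" using z by blast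
    then have "card {u \<in> set x. {u, z} \<in> F} < card (set x)" by (intro psubset_card_mono) auto
    then show ?thesis using card_set_ps[OF x] by simp
  qed
  then have "(\<Sum>z\<in>R. card {u \<in> set x. {u, z} \<in> F}) \<le> (\<Sum>z\<in>R. 3 + of_bool (z \<in> ?full))"
    by (rule sum_mono)
  also have "\<dots> = 3 * card R + card (R \<inter> ?full)"
    using sum_of_bool_eq[of R "\<lambda>z. z \<in> ?full"] finite_R by (simp add: sum.distrib Collect_conj_eq)
  also have "R \<inter> ?full = ?full" by blast
  also have "card ?full \<le> 3" using F_full_le_3[OF x] .
  finally show ?thesis using card_cross_eq_sum[of "set x" R] finite_R by simp
qed

text \<open>If one half of \<open>x\<close> has no neighbor in \<open>V2\<close>, the other half
  gives at most \<open>2 * card V2\<close> pairs. If both have neighbors,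
  \<open>F_halves_same_edge\<close> confines all of them to a single matching edge.\<close>

lemma card_cross_path_V2:
  assumes x: "x \<in> set ps"
  shows "card (cross (set x) V2) \<le> 4 * length ms"
proof -
  obtain a b d e where abde: "x = [a, b, d, e]"
    using length_ps[OF x] by (auto simp: numeral_eq_Suc length_Suc_conv)
  have same: "y = y'" if "w \<in> {a, b}" "w' \<in> {d, e}" "y \<in> set ms" "y' \<in> set ms" "u \<in> set y"
    "u' \<in> set y'" "{w, u} \<in> F" "{w', u'} \<in> F" for w w' y y' u u'
    using F_halves_same_edge[OF x _ _ that(3-)] that(1,2) abde by simp
  have two: "card {p, q} \<le> 2" for p q :: 'v by (simp add: card_insert_if)
  have half: "card (cross {p, q} V2) \<le> 4 * length ms" for p q
  proof -
    have "card (cross {p, q} V2) \<le> card {p, q} * card V2"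
      using finite_V2 by (intro card_cross_le) simp_all
    also have "\<dots> \<le> 2 * card V2" using two by (rule mult_right_mono) simp
    finally show ?thesis by (simp add: card_V2)
  qed
  consider "cross {a, b} V2 = {}" | "cross {d, e} V2 = {}"
    | w u w' u' where "(w, u) \<in> cross {a, b} V2" "(w', u') \<in> cross {d, e} V2"
    by (metis ex_in_conv surj_pair)
  then show ?thesis
  proof cases
    case 1
    then have "cross (set x) V2 \<subseteq> cross {d, e} V2" by (auto simp: cross_def abde)
    then show ?thesis
      using half[of d e] card_mono[OF finite_cross[OF _ finite_V2]] by (meson finite.intros le_trans)
  next
    case 2
    then have "cross (set x) V2 \<subseteq> cross {a, b} V2" by (auto simp: cross_def abde)
    then show ?thesis
      using half[of a b] card_mono[OF finite_cross[OF _ finite_V2]] by (meson finite.intros le_trans)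
  next
    case 3
    then obtain y y' where y: "y \<in> set ms" "u \<in> set y" "y' \<in> set ms" "u' \<in> set y'"
      by (auto simp: cross_def V2_def)
    have w: "w \<in> {a, b}" "{w, u} \<in> F" "w' \<in> {d, e}" "{w', u'} \<in> F"
      using 3 by (auto simp: cross_def)
    have yy: "y = y'" using same[OF w(1,3) y(1,3,2,4) w(2,4)] .
    \<comment> \<open>Each pair is compared with the fixed pair from the opposite half.\<close>
    have "cross (set x) V2 \<subseteq> set x \<times> set y"
    proof (clarsimp simp: cross_def)
      fix p q assume p: "p \<in> set x" "q \<in> V2" "{p, q} \<in> F"
      then obtain y1 where y1: "y1 \<in> set ms" "q \<in> set y1" by (auto simp: V2_def)
      have "y1 = y"
      proof (cases "p \<in> {a, b}")
        case True
        then show ?thesis using same[OF True w(3) y1(1) y(3) y1(2) y(4) p(3) w(4)] yy by simp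
      next
        case False
        then have "p \<in> {d, e}" using p(1) abde by auto
        then show ?thesis using same[OF w(1) _ y(1) y1(1) y(2) y1(2) w(2) p(3)] by simp
      qed
      then show "q \<in> set y" using y1(2) by simp
    qed
    \<comment> \<open>There are at most eight pairs, and \<open>two_le\<close> gives
      \<open>8 \<le> 4 * length ms\<close>.\<close>
    then have "card (cross (set x) V2) \<le> card (set x \<times> set y)" by (intro card_mono) auto
    then show ?thesis
      using card_set_ps[OF x] card_set_ms[OF y(1)] two_le by (simp add: card_cartesian_product)
  qed
qed

lemma card_cross_V4_le:
  assumes "finite Y" "\<And>x. x \<in> set ps \<Longrightarrow> card (cross (set x) Y) \<le> b"
  shows "card (cross V4 Y) \<le> length ps * b"
proof -
  have "cross V4 Y = (\<Union>x\<in>set ps. cross (set x) Y)" by (auto simp: cross_def V4_def)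
  then have "card (cross V4 Y) \<le> (\<Sum>x\<in>set ps. card (cross (set x) Y))"
    by (simp add: card_UN_le)
  also have "\<dots> \<le> card (set ps) * b"
    using sum_bounded_above[of "set ps" "\<lambda>x. card (cross (set x) Y)" b] assms(2) by simp
  also have "\<dots> \<le> length ps * b" by (simp add: card_length)
  finally show ?thesis .
qed

text \<open>With \<open>F_no_V2_V2\<close> and \<open>F_no_R_R\<close>, an edge of \<open>F\<close>
  lies inside \<open>V4\<close> or joins two different classes. Inside \<open>V4\<close> only the
  number of all pairs is used.\<close>

lemma card_F_le:
  "card F \<le> (4 * length ps choose 2) + length ps * (3 * card R + 3) + length ps * (4 * length ms)
    + 2 * card R"
proof -
  let ?E4 = "{e. e \<subseteq> V4 \<and> card e = 2}" and ?pair = "\<lambda>(u, v). {u, v}"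
  have "F \<subseteq> ?E4 \<union> ?pair ` cross V4 R \<union> ?pair ` cross V4 V2 \<union> ?pair ` cross V2 R"
  proof
    fix f assume f: "f \<in> F"
    then obtain u v where uv: "f = {u, v}" using F_edges[OF f] by (auto simp: card_2_iff)
    have "u \<in> V4 \<union> V2 \<union> R" "v \<in> V4 \<union> V2 \<union> R" using F_edges[OF f] uv by (auto simp: R_def)
    moreover have "f \<in> ?pair ` cross X Y" if "u \<in> X \<and> v \<in> Y \<or> v \<in> X \<and> u \<in> Y" for X Y
    proof -
      have "f = {v, u}" using uv by auto
      then have "(u, v) \<in> cross X Y \<or> (v, u) \<in> cross X Y" using that f uv by (simp add: cross_def)
      then show ?thesis using uv \<open>f = {v, u}\<close> by force
    qed
    moreover have "\<not> (u \<in> V2 \<and> v \<in> V2)" "\<not> (u \<in> R \<and> v \<in> R)"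
      using F_no_V2_V2[of u v] F_no_R_R[of u v] f uv by auto
    moreover have "f \<in> ?E4" if "u \<in> V4" "v \<in> V4" using that F_edges[OF f] uv by auto
    ultimately show "f \<in> ?E4 \<union> ?pair ` cross V4 R \<union> ?pair ` cross V4 V2 \<union> ?pair ` cross V2 R"
      unfolding Un_iff by blast
  qed
  then have "card F \<le> card (?E4 \<union> ?pair ` cross V4 R \<union> ?pair ` cross V4 V2 \<union> ?pair ` cross V2 R)"
    using finite_V4 finite_V2 finite_R by (intro card_mono) (simp_all add: finite_cross)
  also have "\<dots> \<le> card ?E4 + card (?pair ` cross V4 R) + card (?pair ` cross V4 V2)
      + card (?pair ` cross V2 R)"
    by (meson add_le_mono1 card_Un_le le_trans)
  also have "\<dots> \<le> card ?E4 + card (cross V4 R) + card (cross V4 V2) + card (cross V2 R)"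
    using finite_V4 finite_V2 finite_R by (intro add_mono card_image_le finite_cross) simp_all
  finally show ?thesis
    using n_subsets[OF finite_V4, of 2] card_V4 card_cross_V2_R
      card_cross_V4_le[OF finite_R card_cross_path_R] card_cross_V4_le[OF finite_V2 card_cross_path_V2]
    by simp
qed

lemma card_B_le: "card B \<le> 3 * length ps + length ms"
proof -
  have "sum_list (map (\<lambda>x. length x - 1) ps) = sum_list (map (\<lambda>_. 3) ps)"
    using length_ps by (intro arg_cong[of _ _ sum_list] map_cong) auto
  moreover have "sum_list (map (\<lambda>x. length x - 1) ms) = sum_list (map (\<lambda>_. 1) ms)"
    using length_ms by (intro arg_cong[of _ _ sum_list] map_cong) auto
  ultimately have "length (concat (map (path_colors c) (ps @ ms))) = 3 * length ps + length ms"
    by (simp add: length_concat o_def length_path_colors sum_list_triv del: sum_list_eq_0_iff)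
  then show ?thesis using card_length unfolding B_used by metis
qed

end

section \<open>Bounds for the number of colors\<close>

lemma has_system_card:
  assumes "finite V" "has_system c V p s"
  shows "4 * p + 2 * s \<le> card V"
proof -
  obtain B ps ms where *: "rainbow_paths c V B (ps @ ms)"
    "\<forall>x\<in>set ps. length x = 4" "\<forall>x\<in>set ms. length x = 2" "length ps = p" "length ms = s"
    using assms(2) unfolding has_system_def by blast
  have "sum_list (map length ps) = sum_list (map (\<lambda>_. 4) ps)"
    using *(2) by (intro arg_cong[of _ _ sum_list] map_cong) auto
  moreover have "sum_list (map length ms) = sum_list (map (\<lambda>_. 2) ms)"
    using *(3) by (intro arg_cong[of _ _ sum_list] map_cong) auto
  ultimately have "length (concat (ps @ ms)) = 4 * p + 2 * s"
    using *(4,5) by (simp add: length_concat sum_list_triv)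
  then have "card (set (concat (ps @ ms))) = 4 * p + 2 * s"
    using *(1) distinct_card unfolding rainbow_paths_def by metis
  then show ?thesis
    using card_mono[OF assms(1), of "set (concat (ps @ ms))"] *(1) unfolding rainbow_paths_def by simp
qed

text \<open>Every color is in \<open>B\<close> or belongs to exactly one edge of \<open>F\<close>,
  so the bounds on \<open>card B\<close> and \<open>card F\<close> add up.\<close>

lemma card_colors_le:
  assumes V: "finite V" and sys: "has_system c V p s" "2 \<le> s"
    and max: "\<not> has_system c V (Suc p) (s - 2)" "\<not> has_system c V p (Suc s)"
    and r: "card V = 4 * p + 2 * s + r"
  shows "card (c ` {e. e \<subseteq> V \<and> card e = 2}) \<le>
    3 * p + s + (4 * p choose 2) + p * (3 * r + 3) + p * (4 * s) + 2 * r"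
proof -
  let ?E = "{e. e \<subseteq> V \<and> card e = 2}"
  obtain B' ps ms where *: "rainbow_paths c V B' (ps @ ms)"
    "\<forall>x\<in>set ps. length x = 4" "\<forall>x\<in>set ms. length x = 2" "length ps = p" "length ms = s"
    using sys(1) unfolding has_system_def by blast
  \<comment> \<open>The bound \<open>B'\<close> may contain colors that do not occur in the system;
    the locale demands the exact set of used colors.\<close>
  define B where "B = set (concat (map (path_colors c) (ps @ ms)))"
  have rp: "rainbow_paths c V B (ps @ ms)"
    using *(1) unfolding rainbow_paths_def B_def by blast
  have "c ` ?E - B \<subseteq> c ` ?E" by blast
  then obtain F where F: "F \<subseteq> ?E" "inj_on c F" "c ` ?E - B = c ` F"
    unfolding subset_image_inj by blast
  interpret maximal_system c V ps ms B F
  proof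
    show "c e \<notin> B" if "e \<in> F" for e
    proof -
      have "c e \<in> c ` ?E - B" unfolding F(3) using that by (rule imageI)
      then show ?thesis by simp
    qed
    show "e \<subseteq> V \<and> card e = 2" if "e \<in> F" for e using F(1) that by blast
    show "length x = 4" if "x \<in> set ps" for x using *(2) that by simp
    show "length y = 2" if "y \<in> set ms" for y using *(3) that by simp
    show "\<not> has_system c V (Suc (length ps)) (length ms - 2)" using max(1) *(4,5) by simp
    show "\<not> has_system c V (length ps) (Suc (length ms))" using max(2) *(4,5) by simp
    show "2 \<le> length ms" using sys(2) *(5) by simp
  qed (fact V rp F(2) B_def)+
  have "finite ?E" using V by (intro finite_subset[of ?E "Pow V"]) auto
  then have finF: "finite F" using F(1) by (rule rev_finite_subset)
  have "c ` ?E \<subseteq> c ` F \<union> B" unfolding F(3)[symmetric] by simp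
  then have "card (c ` ?E) \<le> card (c ` F \<union> B)"
    using finF by (intro card_mono) (simp_all add: B_def)
  also have "\<dots> \<le> card F + card B" using card_Un_le[of "c ` F" B] card_image_le[OF finF, of c] by linarith
  finally show ?thesis
    using card_F_le card_B_le card_V r unfolding *(4,5) by simp
qed

section \<open>Comparison of the upper and lower counts\<close>

lemma two_choose_two: "2 * (n choose 2) = n * (n - 1)"
proof -
  have "even (n * (n - 1))" by (cases n) auto
  then show ?thesis unfolding choose_two by (rule dvd_mult_div_cancel)
qed

lemma choose_two_mono: "a \<le> b \<Longrightarrow> a choose 2 \<le> b choose 2"
  unfolding choose_two by (intro div_le_mono mult_le_mono diff_le_mono)

text \<open>Here \<open>q\<close> is the size of the distinguished vertex set in the extremal
  coloring. The right side is least for \<open>q = 3 * p + 2\<close>, and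
  \<open>s = p + 4 + a\<close> makes everything polynomial in \<open>p\<close>, \<open>a\<close>,
  \<open>r\<close> without subtraction.\<close>

lemma color_bounds_compare:
  fixes n p q r s :: nat
  assumes "3 * p + 2 \<le> q" "p + 4 \<le> s" "n = 4 * p + 2 * s + r"
  shows "3 * p + s + (4 * p choose 2) + p * (3 * r + 3) + p * (4 * s) + 2 * r
    \<le> (n choose 2) - (n - q choose 2) + 1"
proof -
  obtain a where a: "s = p + 4 + a" using assms(2) le_Suc_ex by blast
  \<comment> \<open>This is \<open>n\<close> minus \<open>3 * p + 2\<close>, the least admissible
    \<open>q\<close>.\<close>
  define e where "e = 3 * p + 6 + 2 * a + r"
  have n: "n = 6 * p + 8 + 2 * a + r" using a assms(3) by simp
  have "n - q \<le> e" using assms(1) n by (simp add: e_def)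
  then have "n - q choose 2 \<le> e choose 2" by (rule choose_two_mono)
  moreover have "2 * (e choose 2) = (3 * p + 6 + 2 * a + r) * (3 * p + 5 + 2 * a + r)"
    unfolding two_choose_two e_def by simp
  moreover have "2 * (n choose 2) = (6 * p + 8 + 2 * a + r) * (6 * p + 7 + 2 * a + r)"
    unfolding two_choose_two n by simp
  moreover have "2 * (4 * p choose 2) \<le> (4 * p) * (4 * p)"
    unfolding two_choose_two by (intro mult_le_mono) simp_all
  moreover define x where "x = 3 * p + s + p * (3 * r + 3) + p * (4 * s) + 2 * r"
  \<comment> \<open>After expansion this holds coefficient by coefficient; the coefficients of
    \<open>r\<close> and of \<open>p * r\<close> agree on both sides.\<close>
  moreover have "(3 * p + 6 + 2 * a + r) * (3 * p + 5 + 2 * a + r) + 2 * x + (4 * p) * (4 * p)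
    \<le> (6 * p + 8 + 2 * a + r) * (6 * p + 7 + 2 * a + r) + 2"
    unfolding x_def a by (simp add: algebra_simps)
  ultimately have "2 * (n - q choose 2) + 2 * x + 2 * (4 * p choose 2) \<le> 2 * (n choose 2) + 2"
    by linarith
  then have "x + (4 * p choose 2) \<le> (n choose 2) - (n - q choose 2) + 1" by linarith
  then show ?thesis by (simp add: x_def)
qed

section \<open>The extremal coloring for matchings\<close>

lemma anti_ramsey_ge:
  fixes c :: "nat set \<Rightarrow> nat"
  assumes "\<not> has_rainbow_copy c (complete_graph n) H"
  shows "card (c ` edges (complete_graph n)) \<le> anti_ramsey n H"
  unfolding anti_ramsey_def using assms by (intro Max_ge finite_color_counts CollectI exI[of _ c] conjI refl)

text \<open>Give distinct colors to the edges that meet \<open>{..<q}\<close> and one more color to all others.\<close>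

lemma anti_ramsey_matching_ge:
  assumes "q + 2 \<le> n"
  shows "(n choose 2) - (n - q choose 2) + 1 \<le> anti_ramsey n (copies (q + 2) (path_graph 2))"
proof -
  let ?E = "{e. e \<subseteq> {..<n} \<and> card e = 2}" and ?E' = "{e. e \<subseteq> {q..<n} \<and> card e = 2}"
  have finE: "finite ?E" by (rule finite_subset[of _ "Pow {..<n}"]) auto
  obtain h :: "nat set \<Rightarrow> nat" where h: "inj_on h ?E"
    using finite_imp_inj_to_nat_seg[OF finE] by blast
  \<comment> \<open>\<open>Suc\<close> reserves color 0 for the edges that avoid
    \<open>{..<q}\<close>.\<close>
  define c where "c e = (if e \<inter> {..<q} = {} then 0 else Suc (h e))" for e
  have sub: "?E' \<subseteq> ?E" by auto
  have c0: "c e = 0" if "e \<in> ?E'" for e using that by (auto simp: c_def)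
  have c1: "c e = Suc (h e)" if e: "e \<in> ?E - ?E'" for e
  proof -
    have "\<not> e \<subseteq> {q..<n}" "e \<subseteq> {..<n}" using e by auto
    then obtain x where "x \<in> e" "x < q" by (auto simp: subset_iff not_le)
    then have "e \<inter> {..<q} \<noteq> {}" by auto
    then show ?thesis by (simp add: c_def)
  qed
  \<comment> \<open>Color 0 really occurs because \<open>q + 2 \<le> n\<close>; this accounts for
    the summand 1.\<close>
  have "{q, Suc q} \<in> ?E'" using assms by auto
  then have "(\<lambda>_. 0 :: nat) ` ?E' = {0}" by (rule image_constant)
  moreover have "c ` ?E' = (\<lambda>_. 0) ` ?E'" using c0 by (rule image_cong[OF refl])
  ultimately have "c ` ?E' = {0}" by simp
  moreover have "c ` (?E - ?E') = (\<lambda>e. Suc (h e)) ` (?E - ?E')" using c1 by (rule image_cong[OF refl])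
  moreover have "c ` ?E = c ` ?E' \<union> c ` (?E - ?E')" using sub by blast
  ultimately have cE: "c ` ?E = insert 0 ((\<lambda>e. Suc (h e)) ` (?E - ?E'))" by simp
  moreover have "card ((\<lambda>e. Suc (h e)) ` (?E - ?E')) = card (?E - ?E')"
    using h by (intro card_image) (auto simp: inj_on_def)
  ultimately have "card (c ` ?E) = card (?E - ?E') + 1"
    unfolding cE using finE by (subst card_insert_disjoint) auto
  also have "card (?E - ?E') = card ?E - card ?E'"
    using finE sub by (intro card_Diff_subset) (auto intro: finite_subset)
  also have "card ?E = n choose 2" using n_subsets[of "{..<n}" 2] by simp
  also have "card ?E' = n - q choose 2" using n_subsets[of "{q..<n}" 2] by simp
  finally have "card (c ` edges (complete_graph n)) = (n choose 2) - (n - q choose 2) + 1"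
    by (simp add: complete_graph_def)
  moreover have "\<not> has_rainbow_copy c (complete_graph n) (copies (q + 2) (path_graph 2))"
  proof
    assume "has_rainbow_copy c (complete_graph n) (copies (q + 2) (path_graph 2))"
    then obtain f where f: "inj_on f ({..<q + 2} \<times> {..<2})"
      "inj_on (\<lambda>e. c (f ` e)) ((\<lambda>i. {(i, 0), (i, Suc 0)}) ` {..<q + 2})"
      using has_rainbow_copy_iff[OF simple_graph_copies[OF simple_graph_path_graph], of c n "q + 2" 2]
      by (auto simp: edges_copies_path_graph_2 verts_copies_path_graph)
    define d where "d i = f ` {(i, 0), (i, Suc 0)}" for i
    \<comment> \<open>Disjoint edges that meet \<open>{..<q}\<close> use different vertices of it,
      so \<open>T\<close> has at most \<open>q\<close> elements. The other edges share color 0, so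
      there is at most one of them, and \<open>q + 2\<close> is out of reach.\<close>
    define T where "T = {i \<in> {..<q + 2}. d i \<inter> {..<q} \<noteq> {}}"
    have disj: "i = j" if "v \<in> d i" "v \<in> d j" "i < q + 2" "j < q + 2" for v i j
    proof -
      have "f (i, a) = f (j, b) \<longleftrightarrow> i = j \<and> a = b" if "a < 2" "b < 2" for a b
        using inj_on_eq_iff[OF f(1), of "(i, a)" "(j, b)"] that \<open>i < q + 2\<close> \<open>j < q + 2\<close> by simp
      then show ?thesis using that(1,2) unfolding d_def by auto
    qed
    have "\<forall>i\<in>T. \<exists>v. v \<in> d i \<inter> {..<q}" unfolding T_def by blast
    then obtain g where g: "\<And>i. i \<in> T \<Longrightarrow> g i \<in> d i \<inter> {..<q}" by metis
    have "inj_on g T"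
    proof (rule inj_onI)
      fix i j assume "i \<in> T" "j \<in> T" "g i = g j"
      then show "i = j" using disj[of "g i" i j] g[of i] g[of j] by (simp add: T_def)
    qed
    moreover have "g ` T \<subseteq> {..<q}" using g by blast
    ultimately have T: "card T \<le> q" using card_inj_on_le[of g T "{..<q}"] by simp
    have "i = j" if "i \<in> {..<q + 2} - T" "j \<in> {..<q + 2} - T" for i j
    proof -
      have "c (d i) = c (d j)" using that by (auto simp: T_def c_def)
      then have "{(i, 0), (i, Suc 0)} = {(j, 0), (j, Suc 0)}"
        using that inj_onD[OF f(2), of "{(i, 0), (i, Suc 0)}" "{(j, 0), (j, Suc 0)}"]
        by (simp add: d_def)
      then show ?thesis by (auto simp: doubleton_eq_iff)
    qed
    then have "card ({..<q + 2} - T) \<le> Suc 0" by (subst card_le_Suc0_iff_eq) blast+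
    moreover have "card ({..<q + 2} - T) = q + 2 - card T"
      by (subst card_Diff_subset) (auto simp: T_def)
    ultimately show False using T by linarith
  qed
  ultimately show ?thesis using anti_ramsey_ge by metis
qed

text \<open>The pairs \<open>(p, 2 * k + t - 2 * p)\<close> lead from the rainbow matching at
  \<open>p = 0\<close> to the desired system at \<open>p = k\<close>. Without a copy this chain
  breaks after some \<open>p < k\<close>, and a maximal matching part at that \<open>p\<close>
  contradicts the color count.\<close>

lemma rainbow_matching_imp_rainbow_paths:
  fixes c :: "nat set \<Rightarrow> nat"
  assumes t: "k + 1 \<le> t"
    and many: "anti_ramsey n (copies (2 * k + t) (path_graph 2)) < card (c ` edges (complete_graph n))"
  shows "has_rainbow_copy c (complete_graph n)
    (disjoint_union (copies k (path_graph 4)) (copies t (path_graph 2)))"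
proof (rule ccontr)
  let ?m = "2 * k + t" and ?has = "has_system c {..<n}"
  assume "\<not> ?thesis"
  then have "\<not> ?has k t" using has_system_imp_copy by blast
  moreover have has_0: "?has 0 ?m"
    using anti_ramsey_ge many copy_imp_has_system by (meson not_less)
  ultimately obtain p where p: "p < k" "?has p (?m - 2 * p)" "\<not> ?has (Suc p) (?m - 2 * Suc p)"
  proof -
    have "\<exists>p<k. ?has p (?m - 2 * p) \<and> \<not> ?has (Suc p) (?m - 2 * Suc p)"
    proof (rule ccontr)
      assume no: "\<not> ?thesis"
      have "p \<le> k \<Longrightarrow> ?has p (?m - 2 * p)" for p
      proof (induction p)
        case (Suc p)
        then show ?case using no by (metis Suc_leD Suc_le_eq)
      qed (use has_0 in simp)
      from this[of k] \<open>\<not> ?has k t\<close> show False by simp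
    qed
    then show ?thesis using that by blast
  qed
  have "\<exists>s\<ge>?m - 2 * p. ?has p s \<and> \<not> ?has p (Suc s)"
  proof (rule ccontr)
    assume no: "\<not> ?thesis"
    have "?has p (?m - 2 * p + i)" for i
    proof (induction i)
      case (Suc i)
      then show ?case using no by (metis add_Suc_right le_add1)
    qed (use p(2) in simp)
    \<comment> \<open>With \<open>n\<close> additional matching edges the system would need more
      than \<open>n\<close> vertices.\<close>
    from has_system_card[OF _ this[of n]] show False using p(1) t by simp
  qed
  then obtain s where s: "?m - 2 * p \<le> s" "?has p s" "\<not> ?has p (Suc s)" by blast
  have "\<not> ?has (Suc p) (s - 2)"
  proof
    assume "?has (Suc p) (s - 2)"
    moreover have "?m - 2 * Suc p \<le> s - 2" using s(1) by arith
    ultimately show False using has_system_mono p(3) by blast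
  qed
  moreover obtain r where r: "n = 4 * p + 2 * s + r"
    using has_system_card[OF _ s(2)] le_Suc_ex by auto
  \<comment> \<open>From \<open>p + 1 \<le> k\<close> and \<open>k + 1 \<le> t\<close>:
    \<open>s\<close> is at least \<open>2 * k + t - 2 * p\<close>, hence at least
    \<open>3 * k + 1 - 2 * p\<close>, hence at least \<open>p + 4\<close>.\<close>
  moreover have "p + 4 \<le> s" using s(1) p(1) t by linarith
  ultimately have "card (c ` {e. e \<subseteq> {..<n} \<and> card e = 2}) \<le>
    3 * p + s + (4 * p choose 2) + p * (3 * r + 3) + p * (4 * s) + 2 * r"
    using s by (intro card_colors_le) simp_all
  \<comment> \<open>The choice \<open>q = 2 * k + t - 2\<close> is at least
    \<open>3 * k - 1\<close>, hence at least \<open>3 * p + 2\<close>.\<close>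
  also have "\<dots> \<le> (n choose 2) - (n - (?m - 2) choose 2) + 1"
    using p(1) t r \<open>p + 4 \<le> s\<close> by (intro color_bounds_compare) linarith+
  also have "\<dots> \<le> anti_ramsey n (copies (?m - 2 + 2) (path_graph 2))"
    using r s(1) p(1) t by (intro anti_ramsey_matching_ge) linarith
  also have "?m - 2 + 2 = ?m" using p(1) by simp
  finally show False using many by (simp add: complete_graph_def)
qed

theorem theorem1:
  fixes k t n :: nat
  assumes "t \<ge> k + 1" and "k + 1 \<ge> 2"
    and "n \<ge> 8 * k + 2 * t - 4"
  shows "anti_ramsey n (disjoint_union (copies k (path_graph 4)) (copies t (path_graph 2)))
       = anti_ramsey n (copies (2 * k + t) (path_graph 2))"
proof (rule antisym)
  let ?H = "disjoint_union (copies k (path_graph 4)) (copies t (path_graph 2))"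
    and ?M = "copies (2 * k + t) (path_graph 2)"
  have M: "simple_graph ?M" by (rule simple_graph_copies[OF simple_graph_path_graph])
  \<comment> \<open>Two different edges of \<open>?M\<close> guarantee an admissible coloring, so
    that the maximum is attained.\<close>
  have e: "{(0, 0), (0, Suc 0)} \<in> edges ?M" "{(1, 0), (1, Suc 0)} \<in> edges ?M"
    using assms(2) by (auto simp: edges_copies_path_graph_2)
  have ne: "{(0 :: nat, 0 :: nat), (0, Suc 0)} \<noteq> {(1, 0), (1, Suc 0)}" by (simp add: doubleton_eq_iff)
  have "anti_ramsey n ?M \<in> {card (c ` edges (complete_graph n)) | c :: nat set \<Rightarrow> nat.
      \<not> has_rainbow_copy c (complete_graph n) ?M}"
    unfolding anti_ramsey_def
    by (intro Max_in finite_color_counts color_counts_nonempty[OF M e ne])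
  then obtain c :: "nat set \<Rightarrow> nat" where c: "anti_ramsey n ?M = card (c ` edges (complete_graph n))"
    "\<not> has_rainbow_copy c (complete_graph n) ?M" by blast
  \<comment> \<open>This coloring gives the lower bound and also shows that the maximum for
    \<open>?H\<close> is taken over a nonempty set.\<close>
  then have noH: "\<not> has_rainbow_copy c (complete_graph n) ?H" using has_rainbow_matching by blast
  then show "anti_ramsey n ?M \<le> anti_ramsey n ?H" unfolding c(1) by (rule anti_ramsey_ge)
  have "anti_ramsey n ?H \<in> {card (c ` edges (complete_graph n)) | c :: nat set \<Rightarrow> nat.
      \<not> has_rainbow_copy c (complete_graph n) ?H}"
    unfolding anti_ramsey_def using noH by (intro Max_in finite_color_counts) blast
  then obtain c' :: "nat set \<Rightarrow> nat" where c': "anti_ramsey n ?H = card (c' ` edges (complete_graph n))"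
    "\<not> has_rainbow_copy c' (complete_graph n) ?H" by blast
  show "anti_ramsey n ?H \<le> anti_ramsey n ?M"
  proof (rule ccontr)
    assume "\<not> ?thesis"
    then have "anti_ramsey n ?M < card (c' ` edges (complete_graph n))" using c'(1) by linarith
    from rainbow_matching_imp_rainbow_paths[OF assms(1) this] c'(2) show False by contradiction
  qed
qed

end
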